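(* Let $G=(V,E)$ be any $n$-vertex graph, and for each vertex $v\in V$ let $S(v)$ be a list of $\deg(v)+1$ arbitrary colors. Sample a permutation $\pi: V\to[n]$ uniformly at random and define, for every $v\in V$, \[ \ell(v) := \min\left(\deg(v)+1,\ \frac{40\,n\ln n}{\pi(v)}\right) \] as the size of the list of colors to be sampled for $v$. Then: (1) (List sizes) $\sum_{v\in V}\ell(v)=O(n\log^2 n)$ with certainty; and for any fixed vertices $u\neq v\in V$, $\mathbb{E}[\ell(v)]=O(\log^2 n)$ and $\mathbb{E}[\ell(u)\cdot\ell(v)]=O(\log^4 n)$. (2) (Colorability) If for every vertex $v\in V$ a list $L(v)$ of $\ell(v)$ colors is sampled from $S(v)$ uniformly at random, independently across vertices, then with high probability (over the randomness of $\pi$ and of the sampled lists) the greedy algorithm that iterates over the vertices $v\in V$ in decreasing order of $\pi(v)$ finds a proper list-coloring of $G$ from the lists $\{L(v)\mid v\in V\}$.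
   Context: $[t]=\{1,\dots,t\}$; $\deg(v)$ is the degree of $v$ in $G$. "With high probability" means with probability at least $1-1/\mathrm{poly}(n)$. A proper list-coloring from lists $L(v)$ assigns each vertex $v$ a color in $L(v)$ so that no edge has both endpoints of the same color. The greedy algorithm processes the vertices in the given order and assigns to the current vertex $v$ some color of $L(v)$ not yet assigned to any already-colored neighbor of $v$; it succeeds if such a color exists at every step. *)

theory Defs
  imports "HOL-Probability.Probability" "HOL-Probability.Product_PMF"
begin

definition simple_graph :: "'v set \<Rightarrow> 'v set set \<Rightarrow> bool" where
  "simple_graph V E \<longleftrightarrow> finite V \<and> (\<forall>e\<in>E. e \<subseteq> V \<and> card e = 2)"

definition neighbors :: "'v set set \<Rightarrow> 'v \<Rightarrow> 'v set" where
  "neighbors E v = {u. {u, v} \<in> E}"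

definition deg :: "'v set set \<Rightarrow> 'v \<Rightarrow> nat" where
  "deg E v = card (neighbors E v)"

text \<open>Bijections from \<open>V\<close> to \<open>{1..n}\<close>, made extensional so that each of the \<open>n!\<close>
  permutations is represented by exactly one HOL function.\<close>

definition vertex_perms :: "'v set \<Rightarrow> ('v \<Rightarrow> nat) set" where
  "vertex_perms V = {\<pi> \<in> V \<rightarrow>\<^sub>E {1..card V}. bij_betw \<pi> V {1..card V}}"

definition random_perm :: "'v set \<Rightarrow> ('v \<Rightarrow> nat) pmf" where
  "random_perm V = pmf_of_set (vertex_perms V)"

definition list_size :: "'v set \<Rightarrow> 'v set set \<Rightarrow> ('v \<Rightarrow> nat) \<Rightarrow> 'v \<Rightarrow> real" where
  "list_size V E \<pi> v =
     min (real (deg E v) + 1) (40 * real (card V) * ln (real (card V)) / real (\<pi> v))"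

text \<open>As \<open>list_size\<close> is real-valued, the number of sampled colors is rounded up; since
  \<open>deg E v + 1\<close> is an integer, the rounded value is still at most \<open>deg E v + 1\<close>. Sampling is
  without replacement, so a list is a uniformly random subset of \<open>S v\<close> of the given size.\<close>

definition random_list ::
    "'v set \<Rightarrow> 'v set set \<Rightarrow> ('v \<Rightarrow> 'c set) \<Rightarrow> ('v \<Rightarrow> nat) \<Rightarrow> 'v \<Rightarrow> 'c set pmf" where
  "random_list V E S \<pi> v =
     pmf_of_set {A. A \<subseteq> S v \<and> card A = nat \<lceil>list_size V E \<pi> v\<rceil>}"

definition random_perm_and_lists ::
    "'v set \<Rightarrow> 'v set set \<Rightarrow> ('v \<Rightarrow> 'c set) \<Rightarrow> (('v \<Rightarrow> nat) \<times> ('v \<Rightarrow> 'c set)) pmf" where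
  "random_perm_and_lists V E S =
     bind_pmf (random_perm V) (\<lambda>\<pi>. map_pmf (Pair \<pi>) (Pi_pmf V {} (random_list V E S \<pi>)))"

definition proper_list_coloring ::
    "'v set \<Rightarrow> 'v set set \<Rightarrow> ('v \<Rightarrow> 'c set) \<Rightarrow> ('v \<rightharpoonup> 'c) \<Rightarrow> bool" where
  "proper_list_coloring V E L \<sigma> \<longleftrightarrow>
     dom \<sigma> = V \<and> (\<forall>v\<in>V. the (\<sigma> v) \<in> L v) \<and> (\<forall>u v. {u, v} \<in> E \<longrightarrow> \<sigma> u \<noteq> \<sigma> v)"

definition available ::
    "'v set set \<Rightarrow> ('v \<Rightarrow> 'c set) \<Rightarrow> ('v \<rightharpoonup> 'c) \<Rightarrow> 'v \<Rightarrow> 'c set" where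
  "available E L \<sigma> v = L v - {c. \<exists>u\<in>neighbors E v. \<sigma> u = Some c}"

text \<open>The greedy algorithm picks \<^emph>\<open>some\<close> available color. Its choice is modelled by a rule that
  may depend on everything the algorithm has seen so far: the permutation, the lists of the
  vertices processed up to now (including the current one), the current partial coloring, the
  current vertex and its set of available colors. It must not depend on the lists of vertices
  that are still to be processed.\<close>

type_synonym ('v, 'c) choice_rule =
  "('v \<Rightarrow> nat) \<Rightarrow> ('v \<Rightarrow> 'c set) \<Rightarrow> ('v \<rightharpoonup> 'c) \<Rightarrow> 'v \<Rightarrow> 'c set \<Rightarrow> 'c"

definition valid_rule :: "('v, 'c) choice_rule \<Rightarrow> bool" where
  "valid_rule r \<longleftrightarrow> (\<forall>\<pi> M \<sigma> v A. A \<noteq> {} \<longrightarrow> r \<pi> M \<sigma> v A \<in> A)"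

primrec greedy_from ::
    "'v set set \<Rightarrow> ('v \<Rightarrow> 'c set) \<Rightarrow> ('v, 'c) choice_rule \<Rightarrow> ('v \<Rightarrow> nat) \<Rightarrow>
     'v list \<Rightarrow> ('v \<rightharpoonup> 'c) \<Rightarrow> ('v \<rightharpoonup> 'c) option" where
  "greedy_from E L r \<pi> [] \<sigma> = Some \<sigma>"
| "greedy_from E L r \<pi> (v # vs) \<sigma> =
     (if available E L \<sigma> v = {} then None
      else greedy_from E L r \<pi> vs
             (\<sigma>(v \<mapsto> r \<pi> (restrict L (insert v (dom \<sigma>))) \<sigma> v (available E L \<sigma> v))))"

definition decreasing_order :: "'v set \<Rightarrow> ('v \<Rightarrow> nat) \<Rightarrow> 'v list" where
  "decreasing_order V \<pi> = map (inv_into V \<pi>) (rev [1..<Suc (card V)])"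

definition greedy ::
    "'v set \<Rightarrow> 'v set set \<Rightarrow> ('v, 'c) choice_rule \<Rightarrow> ('v \<Rightarrow> nat) \<Rightarrow> ('v \<Rightarrow> 'c set) \<Rightarrow>
     ('v \<rightharpoonup> 'c) option" where
  "greedy V E r \<pi> L = greedy_from E L r \<pi> (decreasing_order V \<pi>) Map.empty"

end

theory Submission
  imports Defs
begin

text \<open>
  Bounding \<open>list_size\<close> by its second argument reduces the claims on list sizes to harmonic sums.

  For colorability with \<open>n \<ge> 2\<close>, fix \<open>\<pi>\<close> and process the vertices in decreasing order, revealing each
  list only when its vertex is reached. Write \<open>d\<close> for the degree of \<open>v\<close>, \<open>s\<close> for the number of colors
  sampled for \<open>v\<close>, \<open>B\<close> for the number of neighbors that come after \<open>v\<close>, and \<open>t = s / (d + 1)\<close>. At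
  least \<open>B + 1\<close> colors of \<open>S v\<close> are unused by the neighbors when \<open>v\<close> is reached, and a random
  \<open>s\<close>-subset misses all of them with probability at most \<open>(1 - t) ^ (B + 1)\<close>. This vanishes if
  \<open>s = d + 1\<close>.

  Otherwise condition on \<open>\<pi> v = i\<close>, so that \<open>B\<close> is hypergeometric, each neighbor coming after \<open>v\<close> with
  probability \<open>p = (i - 1) / (n - 1)\<close>. Let \<open>K\<close> contain each neighbor independently with probability
  \<open>t\<close>; then \<open>(1 - t) ^ B\<close> is the probability that no vertex of \<open>K\<close> comes after \<open>v\<close>. Averaging over
  \<open>\<pi>\<close> first bounds its expectation by that of \<open>(1 - p) ^ |K|\<close>, which is
  \<open>(1 - t p) ^ d \<le> exp (- t p d) \<le> 1 / n\<^sup>2\<close>. A union bound over the vertices yields the failure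
  probability \<open>1 / n\<close>.
\<close>

section \<open>Sums over bijections\<close>

text \<open>Domain and target are arbitrary so that inductions can delete a vertex together with its
  value.\<close>

definition bijections :: "'a set \<Rightarrow> 'b set \<Rightarrow> ('a \<Rightarrow> 'b) set" where
  "bijections V T = {f \<in> V \<rightarrow>\<^sub>E T. bij_betw f V T}"

lemma vertex_perms_eq_bijections: "vertex_perms V = bijections V {1..card V}"
  by (simp add: vertex_perms_def bijections_def)

lemma finite_bijections: "finite V \<Longrightarrow> finite T \<Longrightarrow> finite (bijections V T)"
  unfolding bijections_def by (rule finite_subset[of _ "V \<rightarrow>\<^sub>E T"]) (auto intro: finite_PiE)

text \<open>Resetting \<open>w\<close> to \<open>undefined\<close> inverts the update, since an
  extensional function on \<open>V - {w}\<close> already has that value at \<open>w\<close>.\<close>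

lemma bijections_fix_point:
  assumes "w \<in> V" "t \<in> T"
  shows "bij_betw (\<lambda>f. f(w := t)) (bijections (V - {w}) (T - {t})) {f \<in> bijections V T. f w = t}"
proof (rule bij_betw_byWitness[where f' = "\<lambda>f. f(w := undefined)"])
  show "\<forall>f\<in>bijections (V - {w}) (T - {t}). (f(w := t))(w := undefined) = f"
    by (auto simp: bijections_def PiE_def extensional_def fun_eq_iff)
  show "\<forall>f\<in>{f \<in> bijections V T. f w = t}. (f(w := undefined))(w := t) = f"
    by auto
  show "(\<lambda>f. f(w := t)) ` bijections (V - {w}) (T - {t}) \<subseteq> {f \<in> bijections V T. f w = t}"
  proof safe
    fix f assume f: "f \<in> bijections (V - {w}) (T - {t})"
    then have "bij_betw (f(w := t)) (V - {w}) (T - {t})"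
      by (subst bij_betw_cong[of _ _ f]) (auto simp: bijections_def)
    then have "bij_betw (f(w := t)) (insert w (V - {w})) (insert ((f(w := t)) w) (T - {t}))"
      using notIn_Un_bij_betw[of w "V - {w}" "f(w := t)" "T - {t}"] by simp
    moreover have "insert w (V - {w}) = V" "insert t (T - {t}) = T" using assms by auto
    ultimately have "bij_betw (f(w := t)) V T" by simp
    then show "f(w := t) \<in> bijections V T"
      using f assms by (auto simp: bijections_def PiE_def extensional_def Pi_def)
  qed simp
  show "(\<lambda>f. f(w := undefined)) ` {f \<in> bijections V T. f w = t} \<subseteq> bijections (V - {w}) (T - {t})"
  proof safe
    fix f assume f: "f \<in> bijections V T" and t: "t = f w"
    have "bij_betw f V T" using f by (simp add: bijections_def)
    then have bij: "bij_betw f (V - {w}) (T - {f w})"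
      using assms(1) by (auto simp: bij_betw_def inj_on_def)
    then have "bij_betw (f(w := undefined)) (V - {w}) (T - {f w})"
      by (subst bij_betw_cong[of _ _ f]) auto
    then show "f(w := undefined) \<in> bijections (V - {w}) (T - {f w})"
      using f bij by (auto simp: bijections_def PiE_def extensional_def Pi_def bij_betw_def)
  qed
qed

lemma sum_bijections_fix_point:
  fixes g :: "('a \<Rightarrow> 'b) \<Rightarrow> 'c :: comm_monoid_add"
  assumes "finite V" "finite T" "w \<in> V"
  shows "(\<Sum>f\<in>bijections V T. g f) =
         (\<Sum>t\<in>T. \<Sum>f\<in>bijections (V - {w}) (T - {t}). g (f(w := t)))"
proof -
  have "(\<Sum>f\<in>bijections V T. g f) = (\<Sum>t\<in>T. \<Sum>f\<in>{f \<in> bijections V T. f w = t}. g f)"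
    using assms by (intro sum.group[symmetric] finite_bijections) (auto simp: bijections_def)
  also have "\<dots> = (\<Sum>t\<in>T. \<Sum>f\<in>bijections (V - {w}) (T - {t}). g (f(w := t)))"
    by (intro sum.cong refl sum.reindex_bij_betw[symmetric] bijections_fix_point assms)
  finally show ?thesis .
qed

lemma card_bijections:
  assumes "finite V" "finite T" "card V = card T"
  shows "card (bijections V T) = fact (card V)"
  using assms
proof (induction V arbitrary: T rule: finite_induct)
  case empty
  then show ?case by (auto simp: bijections_def bij_betw_def)
next
  case (insert w V)
  have "card (bijections (insert w V) T) = (\<Sum>f\<in>bijections (insert w V) T. 1)" by simp
  also have "\<dots> = (\<Sum>t\<in>T. \<Sum>f\<in>bijections (insert w V - {w}) (T - {t}). 1)"
    using insert.prems insert.hyps by (intro sum_bijections_fix_point) auto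
  also have "\<dots> = (\<Sum>t\<in>T. card (bijections V (T - {t})))"
    using insert.hyps by simp
  also have "\<dots> = (\<Sum>t\<in>T. fact (card V))"
    using insert by (intro sum.cong refl insert.IH) auto
  also have "\<dots> = fact (card (insert w V))"
    using insert.hyps insert.prems by (simp flip: insert.prems(2))
  finally show ?case .
qed

lemma sum_bijections_value:
  fixes g :: "'b \<Rightarrow> real"
  assumes "finite V" "finite T" "card V = card T" "w \<in> V"
  shows "(\<Sum>f\<in>bijections V T. g (f w)) = fact (card V - 1) * (\<Sum>t\<in>T. g t)"
  using assms
  by (subst sum_bijections_fix_point[of _ _ w]) (auto simp: card_bijections sum_distrib_left)

text \<open>All ordered pairs of distinct values occur equally often;
  \<open>fact (card V - 2)\<close> counts the completions of one pair.\<close>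

lemma sum_bijections_value_pair:
  fixes g h :: "'b \<Rightarrow> real"
  assumes "finite V" "finite T" "card V = card T" "u \<in> V" "w \<in> V" "u \<noteq> w"
  shows "(\<Sum>f\<in>bijections V T. g (f u) * h (f w)) =
         fact (card V - 2) * (\<Sum>t\<in>T. \<Sum>t'\<in>T - {t}. g t * h t')"
proof -
  have "(\<Sum>f\<in>bijections V T. g (f u) * h (f w)) =
        (\<Sum>t\<in>T. g t * (\<Sum>f\<in>bijections (V - {u}) (T - {t}). h (f w)))"
    using assms by (subst sum_bijections_fix_point[of _ _ u]) (auto simp: sum_distrib_left)
  also have "\<dots> = (\<Sum>t\<in>T. g t * (fact (card V - 2) * (\<Sum>t'\<in>T - {t}. h t')))"
    using assms by (intro sum.cong refl, subst sum_bijections_value) (auto simp: numeral_2_eq_2)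
  finally show ?thesis
    by (simp add: sum_distrib_left mult_ac)
qed

text \<open>Without replacement, the constraints are negatively correlated: after one value of
  \<open>T0\<close> has been used up, a smaller fraction of the remaining values lies in \<open>T0\<close>.\<close>

lemma sum_bijections_into_le:
  assumes "finite V" "finite T" "card V = card T" "K \<subseteq> V" "T0 \<subseteq> T"
  shows "(\<Sum>f\<in>bijections V T. \<Prod>w\<in>K. of_bool (f w \<in> T0)) \<le>
         fact (card V) * (real (card T0) / real (card V)) ^ card K"
proof -
  have "finite K" using assms finite_subset by blast
  then show ?thesis using assms
  proof (induction K arbitrary: V T T0 rule: finite_induct)
    case empty
    then show ?case by (simp add: card_bijections)
  next
    case (insert w K)
    have w: "w \<in> V" and fin0: "finite T0" using insert.prems finite_subset by auto
    have pos: "card V > 0" using w insert.prems(1) by (auto simp: card_gt_0_iff)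
    have le0: "card T0 \<le> card V" using insert.prems by (simp add: card_mono)
    let ?q = "real (card T0) / real (card V)"
    have "(\<Sum>f\<in>bijections V T. \<Prod>w\<in>insert w K. of_bool (f w \<in> T0)) =
      (\<Sum>t\<in>T. \<Sum>f\<in>bijections (V - {w}) (T - {t}). of_bool (t \<in> T0) * (\<Prod>x\<in>K. of_bool (f x \<in> T0)))"
      using insert.prems insert.hyps w
      by (subst sum_bijections_fix_point[of _ _ w])
         (auto intro!: sum.cong prod.cong arg_cong2[where f = "(*)"])
    \<comment> \<open>By injectivity no later vertex reuses \<open>t\<close>, so \<open>T0\<close>
      shrinks to \<open>T0 - {t}\<close>, a subset of \<open>T - {t}\<close> as the induction
      hypothesis needs.\<close>
    also have "\<dots> = (\<Sum>t\<in>T. of_bool (t \<in> T0) *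
      (\<Sum>f\<in>bijections (V - {w}) (T - {t}). \<Prod>x\<in>K. of_bool (f x \<in> T0 - {t}) :: real))"
    proof -
      have "f x \<in> T - {t}" if "f \<in> bijections (V - {w}) (T - {t})" "x \<in> K" for f t x
        using that insert.prems(4) insert.hyps(2) by (auto simp: bijections_def PiE_def Pi_def)
      then show ?thesis
        by (auto simp: sum_distrib_left intro!: sum.cong prod.cong arg_cong2[where f = "(*)"])
    qed
    also have "\<dots> \<le> (\<Sum>t\<in>T. of_bool (t \<in> T0) * (fact (card V - 1) * ?q ^ card K))"
    proof (intro sum_mono)
      fix t assume t: "t \<in> T"
      show "of_bool (t \<in> T0) *
          (\<Sum>f\<in>bijections (V - {w}) (T - {t}). \<Prod>x\<in>K. of_bool (f x \<in> T0 - {t}) :: real)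
        \<le> of_bool (t \<in> T0) * (fact (card V - 1) * ?q ^ card K)"
      proof (cases "t \<in> T0")
        case True
        have "(\<Sum>f\<in>bijections (V - {w}) (T - {t}). \<Prod>x\<in>K. of_bool (f x \<in> T0 - {t}) :: real)
          \<le> fact (card (V - {w})) * (real (card (T0 - {t})) / real (card (V - {w}))) ^ card K"
          using insert.prems insert.hyps w t True by (intro insert.IH) auto
        also have "\<dots> \<le> fact (card V - 1) * ?q ^ card K"
        proof -
          have c: "card T0 > 0" using True fin0 by (auto simp: card_gt_0_iff)
          \<comment> \<open>Subtracting 1 from numerator and denominator lowers a fraction that is
            at most 1. If \<open>card V = 1\<close>, the left side is a division by zero, hence
            0.\<close>
          have "real (card T0 - 1) / real (card V - 1) \<le> ?q"
          proof (cases "card V = 1")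
            case False
            then show ?thesis using c pos le0
              by (simp add: field_simps of_nat_diff)
          qed simp
          then show ?thesis
            using insert.prems(1) fin0 w True by (auto intro!: power_mono)
        qed
        finally show ?thesis using True by simp
      qed simp
    qed
    also have "\<dots> = real (card T0) * (fact (card V - 1) * ?q ^ card K)"
      using insert.prems by (simp add: sum_distrib_right[symmetric] Int_absorb1)
    also have "\<dots> = fact (card V) * ?q ^ card (insert w K)"
      using pos insert.hyps by (simp add: fact_reduce[of "card V"])
    finally show ?case .
  qed
qed

text \<open>A generating function comparison of sampling without replacement to independent
  sampling. Expanding the product over \<open>N\<close> gives a mixture over random subsets
  \<open>K\<close> that include each element with probability \<open>1 - z\<close>; each term is
  bounded by negative correlation, and the bounds fold back into a product.\<close>

lemma sum_bijections_power_le: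
  assumes "finite V" "finite T" "card V = card T" "N \<subseteq> V" "T0 \<subseteq> T" and z: "0 \<le> z" "z \<le> (1::real)"
  shows "(\<Sum>f\<in>bijections V T. z ^ card {w \<in> N. f w \<notin> T0}) \<le>
         fact (card V) * (z + (1 - z) * (real (card T0) / real (card V))) ^ card N"
proof -
  have fN: "finite N" using assms finite_subset by blast
  let ?q = "real (card T0) / real (card V)"
  have expand: "z ^ card {w \<in> N. f w \<notin> T0} =
      (\<Sum>K\<in>Pow N. (1 - z) ^ card K * z ^ card (N - K) * (\<Prod>w\<in>K. of_bool (f w \<in> T0)))" for f :: "'a \<Rightarrow> 'b"
  proof -
    have "z ^ card {w \<in> N. f w \<notin> T0} = (\<Prod>w\<in>N. if f w \<notin> T0 then z else 1)"
      using fN by (simp add: prod.If_cases Int_def)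
    \<comment> \<open>Each factor is 1 if \<open>f w\<close> lies in \<open>T0\<close> and
      \<open>z\<close> otherwise; the affine form is what \<open>prod_add\<close> expands.\<close>
    also have "\<dots> = (\<Prod>w\<in>N. (1 - z) * of_bool (f w \<in> T0) + z)"
      by (intro prod.cong) auto
    also have "\<dots> = (\<Sum>K\<in>Pow N. (\<Prod>w\<in>K. (1 - z) * of_bool (f w \<in> T0)) * (\<Prod>w\<in>N - K. z))"
      by (rule prod_add[OF fN])
    finally show ?thesis by (simp add: prod.distrib mult_ac)
  qed
  have "(\<Sum>f\<in>bijections V T. z ^ card {w \<in> N. f w \<notin> T0}) =
      (\<Sum>K\<in>Pow N. (1 - z) ^ card K * z ^ card (N - K) *
         (\<Sum>f\<in>bijections V T. \<Prod>w\<in>K. of_bool (f w \<in> T0)))"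
    unfolding expand by (subst sum.swap) (simp add: sum_distrib_left)
  also have "\<dots> \<le> (\<Sum>K\<in>Pow N. (1 - z) ^ card K * z ^ card (N - K) * (fact (card V) * ?q ^ card K))"
    using assms by (intro sum_mono mult_left_mono sum_bijections_into_le) auto
  also have "\<dots> = fact (card V) * (\<Sum>K\<in>Pow N. (\<Prod>w\<in>K. (1 - z) * ?q) * (\<Prod>w\<in>N - K. z))"
    by (simp add: sum_distrib_left power_mult_distrib power_divide mult_ac)
  also have "(\<Sum>K\<in>Pow N. (\<Prod>w\<in>K. (1 - z) * ?q) * (\<Prod>w\<in>N - K. z)) = (\<Prod>w\<in>N. (1 - z) * ?q + z)"
    by (rule prod_add[OF fN, symmetric])
  finally show ?thesis by (simp add: add.commute)
qed

section \<open>Random subsets and list sizes\<close>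

text \<open>Elements are removed one at a time: going from \<open>M + 1\<close> to \<open>M\<close>
  elements multiplies the count by \<open>1 - s / (M + 1)\<close>, at most
  \<open>1 - s / m\<close>.\<close>

lemma choose_diff_le:
  assumes "a \<le> m" "s \<le> m"
  shows "real ((m - a) choose s) \<le> (1 - real s / real m) ^ a * real (m choose s)"
  using assms(1)
proof (induction a)
  case (Suc a)
  define M where "M = m - Suc a"
  have M: "m - a = Suc M" "real M + 1 \<le> real m" "m > 0" using Suc.prems by (auto simp: M_def)
  have "real (M choose s) \<le> (1 - real s / real m) * real (Suc M choose s)"
  proof (cases "s \<le> M")
    case True
    have "real (Suc M choose s) * real (Suc M - s) = real (Suc M) * real (M choose s)"
      using arg_cong[OF binomial_absorb_comp[of "Suc M" s], of real]
      unfolding of_nat_mult diff_Suc_1 by (simp only: mult.commute)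
    then have "real (M choose s) = (1 - real s / real (Suc M)) * real (Suc M choose s)"
      using True by (simp add: field_simps of_nat_diff)
    moreover have "real s / real m \<le> real s / real (Suc M)"
      using M by (intro divide_left_mono) auto
    ultimately show ?thesis by (simp add: mult_right_mono)
  next
    case False
    then show ?thesis using M assms(2) by (simp add: binomial_eq_0)
  qed
  also have "\<dots> \<le> (1 - real s / real m) * ((1 - real s / real m) ^ a * real (m choose s))"
    using Suc M assms(2) by (intro mult_left_mono) auto
  finally show ?case by (simp add: M_def mult.assoc)
qed simp

lemma prob_random_subset_misses:
  assumes "finite S" "A \<subseteq> S" "s \<le> card S"
  shows "measure_pmf.prob (pmf_of_set {X. X \<subseteq> S \<and> card X = s}) {X. X \<inter> A = {}}
         \<le> (1 - real s / real (card S)) ^ card A"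
proof -
  let ?P = "{X. X \<subseteq> S \<and> card X = s}"
  have card: "card ?P = card S choose s" using n_subsets[OF assms(1)] by simp
  have pos: "card S choose s > 0" using assms(3) by simp
  then have ne: "?P \<noteq> {}" using card by (metis card.empty less_irrefl)
  have fin: "finite ?P" using assms(1) by auto
  have "?P \<inter> {X. X \<inter> A = {}} = {X. X \<subseteq> S - A \<and> card X = s}" by auto
  then have "card (?P \<inter> {X. X \<inter> A = {}}) = (card S - card A) choose s"
    using n_subsets[of "S - A" s] assms finite_subset[OF assms(2,1)] by (simp add: card_Diff_subset)
  then have "measure_pmf.prob (pmf_of_set ?P) {X. X \<inter> A = {}} =
      real ((card S - card A) choose s) / real (card S choose s)"
    using measure_pmf_of_set[OF ne fin] card by simp
  also have "\<dots> \<le> (1 - real s / real (card S)) ^ card A"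
    using choose_diff_le[of "card A" "card S" s] assms pos by (simp add: card_mono pos_divide_le_eq)
  finally show ?thesis .
qed

section \<open>Sum and moments of the list sizes\<close>

lemma list_size_nonneg: "0 \<le> list_size V E \<pi> v"
proof (cases "card V = 0")
  case False
  then have "0 \<le> ln (real (card V))" by simp
  then show ?thesis by (simp add: list_size_def)
qed (simp add: list_size_def)

lemma list_size_le_inverse:
  "list_size V E \<pi> v \<le> 40 * real (card V) * ln (real (card V)) * inverse (real (\<pi> v))"
  by (simp add: list_size_def divide_inverse)

text \<open>The harmonic number minus the logarithm is decreasing, hence at most its value 1 at
  \<open>n = 1\<close>; for \<open>n \<ge> 2\<close> this 1 is absorbed by
  \<open>2 * ln n\<close>.\<close>

lemma sum_inverse_le_ln:
  assumes "n \<ge> 2"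
  shows "(\<Sum>i=1..n. inverse (real i)) \<le> 3 * ln (real n)"
proof -
  obtain m where m: "n = Suc m" using assms by (cases n) auto
  have "harm (Suc m) - ln (real (Suc m)) \<le> harm (Suc 0) - ln (real (Suc 0))"
    using decseqD[OF decseq_harm_diff_ln, of 0 m] by simp
  moreover have "1 \<le> 2 * ln (real n)"
  proof -
    have "ln 2 \<le> ln (real n)" using assms by simp
    then show ?thesis using ln2_ge_two_thirds by linarith
  qed
  ultimately show ?thesis by (simp add: m harm_def)
qed

lemma sum_list_size_le:
  assumes "simple_graph V E" "\<pi> \<in> vertex_perms V"
  shows "(\<Sum>v\<in>V. list_size V E \<pi> v) \<le> 120 * (real (card V) * (ln (real (card V)))\<^sup>2)"
proof -
  let ?n = "real (card V)"
  have bij: "bij_betw \<pi> V {1..card V}" using assms by (simp add: vertex_perms_def)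
  have *: "(\<Sum>v\<in>V. list_size V E \<pi> v) \<le> 40 * ?n * ln ?n * (\<Sum>i=1..card V. inverse (real i))"
  proof -
    have "(\<Sum>v\<in>V. list_size V E \<pi> v) \<le> (\<Sum>v\<in>V. 40 * ?n * ln ?n * inverse (real (\<pi> v)))"
      by (intro sum_mono list_size_le_inverse)
    also have "\<dots> = 40 * ?n * ln ?n * (\<Sum>i=1..card V. inverse (real i))"
      using sum.reindex_bij_betw[OF bij, of "\<lambda>i. 40 * ?n * ln ?n * inverse (real i)"]
      by (simp add: sum_distrib_left)
    finally show ?thesis .
  qed
  show ?thesis
  proof (cases "card V \<ge> 2")
    case True
    then have "40 * ?n * ln ?n * (\<Sum>i=1..card V. inverse (real i)) \<le> 40 * ?n * ln ?n * (3 * ln ?n)"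
      by (intro mult_left_mono sum_inverse_le_ln) auto
    then show ?thesis using * by (simp add: power2_eq_square)
  next
    \<comment> \<open>The harmonic estimate fails for one vertex, as \<open>ln 1 = 0\<close>, but
      the bound just proved is then already 0, as it is for the empty graph.\<close>
    case False
    then have "card V = 0 \<or> card V = 1" by auto
    then show ?thesis using * by auto
  qed
qed

lemma expectation_random_perm:
  fixes g :: "('v \<Rightarrow> nat) \<Rightarrow> real"
  assumes "finite V"
  shows "measure_pmf.expectation (random_perm V) g =
         (\<Sum>\<pi>\<in>bijections V {1..card V}. g \<pi>) / fact (card V)"
proof -
  have card: "card (bijections V {1..card V}) = fact (card V)"
    using assms by (intro card_bijections) auto
  then have ne: "bijections V {1..card V} \<noteq> {}" by (metis card.empty fact_nonzero)
  have fin: "finite (bijections V {1..card V})"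
    using assms by (simp add: finite_bijections)
  show ?thesis
    unfolding random_perm_def vertex_perms_eq_bijections
    by (simp only: integral_pmf_of_set[OF ne fin] card of_nat_fact)
qed

lemma expectation_list_size_le:
  assumes "simple_graph V E" "v \<in> V"
  shows "measure_pmf.expectation (random_perm V) (\<lambda>\<pi>. list_size V E \<pi> v)
         \<le> 120 * (ln (real (card V)))\<^sup>2"
proof -
  let ?n = "real (card V)" and ?T = "{1..card V}"
  have fin: "finite V" using assms by (simp add: simple_graph_def)
  have pos: "card V > 0" using fin assms(2) by (auto simp: card_gt_0_iff)
  define H where "H = (\<Sum>i=1..card V. inverse (real i))"
  have "(\<Sum>\<pi>\<in>bijections V ?T. list_size V E \<pi> v) \<le>
        (\<Sum>\<pi>\<in>bijections V ?T. 40 * ?n * ln ?n * inverse (real (\<pi> v)))"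
    by (intro sum_mono list_size_le_inverse)
  also have "\<dots> = fact (card V - 1) * (\<Sum>i\<in>?T. 40 * ?n * ln ?n * inverse (real i))"
    using fin assms(2) by (intro sum_bijections_value) auto
  \<comment> \<open>The factor \<open>card V\<close> of the list size completes the
    factorial.\<close>
  also have "\<dots> = fact (card V) * (40 * ln ?n * H)"
    using pos by (simp add: H_def fact_reduce[of "card V"] sum_distrib_left mult_ac)
  finally have *: "measure_pmf.expectation (random_perm V) (\<lambda>\<pi>. list_size V E \<pi> v) \<le> 40 * ln ?n * H"
    unfolding expectation_random_perm[OF fin] by (simp add: divide_le_eq mult.commute)
  show ?thesis
  proof (cases "card V \<ge> 2")
    case True
    then have "40 * ln ?n * H \<le> 40 * ln ?n * (3 * ln ?n)"
      unfolding H_def by (intro mult_left_mono sum_inverse_le_ln) auto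
    also have "\<dots> = 120 * (ln ?n)\<^sup>2" by (simp add: power2_eq_square)
    finally show ?thesis using * by linarith
  next
    case False
    then have "card V = 1" using pos by auto
    then show ?thesis using * by auto
  qed
qed

lemma expectation_list_size_mult_le:
  assumes "simple_graph V E" "u \<in> V" "v \<in> V" "u \<noteq> v"
  shows "measure_pmf.expectation (random_perm V) (\<lambda>\<pi>. list_size V E \<pi> u * list_size V E \<pi> v)
         \<le> 28800 * (ln (real (card V))) ^ 4"
proof -
  let ?n = "real (card V)" and ?T = "{1..card V}"
  let ?g = "\<lambda>i. 40 * ?n * ln ?n * inverse (real i)"
  have fin: "finite V" using assms by (simp add: simple_graph_def)
  have n2: "card V \<ge> 2" using card_mono[OF fin, of "{u, v}"] assms by simp
  then have ln: "ln ?n \<ge> 0" by simp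
  define H where "H = (\<Sum>i=1..card V. inverse (real i))"
  have H: "0 \<le> H" "H \<le> 3 * ln ?n"
    unfolding H_def using n2 by (auto intro!: sum_nonneg sum_inverse_le_ln[simplified])
  have "(\<Sum>\<pi>\<in>bijections V ?T. list_size V E \<pi> u * list_size V E \<pi> v) \<le>
        (\<Sum>\<pi>\<in>bijections V ?T. ?g (\<pi> u) * ?g (\<pi> v))"
    using ln by (intro sum_mono mult_mono list_size_le_inverse list_size_nonneg) auto
  also have "\<dots> = fact (card V - 2) * (\<Sum>i\<in>?T. \<Sum>j\<in>?T - {i}. ?g i * ?g j)"
    using fin assms by (intro sum_bijections_value_pair) auto
  \<comment> \<open>Adding the nonnegative diagonal terms lets the double sum factor into a
    square.\<close>
  also have "\<dots> \<le> fact (card V - 2) * (\<Sum>i\<in>?T. \<Sum>j\<in>?T. ?g i * ?g j)"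
    using ln by (intro mult_left_mono sum_mono sum_mono2) auto
  also have "(\<Sum>i\<in>?T. \<Sum>j\<in>?T. ?g i * ?g j) = (40 * ?n * ln ?n * H)\<^sup>2"
    by (simp add: H_def sum_product power2_eq_square sum_distrib_left mult_ac)
  also have "fact (card V - 2) * (40 * ?n * ln ?n * H)\<^sup>2 \<le>
             fact (card V - 2) * (40 * ?n * ln ?n * (3 * ln ?n))\<^sup>2"
    using ln H by (intro mult_left_mono power_mono) auto
  also have "\<dots> = fact (card V - 2) * ?n * ?n * (14400 * ln ?n ^ 4)"
    by (simp add: power2_eq_square power4_eq_xxxx)
  \<comment> \<open>Using \<open>n \<le> 2 * (n - 1)\<close> completes the factorial and doubles
    14400, the square of 120.\<close>
  also have "\<dots> \<le> fact (card V - 2) * ?n * (2 * (?n - 1)) * (14400 * ln ?n ^ 4)"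
    using n2 by (intro mult_right_mono mult_left_mono) auto
  also have "\<dots> = fact (card V) * (28800 * ln ?n ^ 4)"
  proof -
    obtain m where "card V = Suc (Suc m)" using n2 by (metis Suc_le_D numeral_2_eq_2 Suc_le_mono)
    then show ?thesis by (simp add: algebra_simps)
  qed
  finally show ?thesis
    unfolding expectation_random_perm[OF fin] by (simp add: divide_le_eq mult.commute)
qed

section \<open>The greedy algorithm\<close>

lemma prob_bind_pmf_eq_expectation:
  "measure_pmf.prob (bind_pmf p f) A = measure_pmf.expectation p (\<lambda>x. measure_pmf.prob (f x) A)"
proof -
  have int: "integrable (measure_pmf p) (\<lambda>x. measure_pmf.prob (f x) A)"
    by (rule measure_pmf.integrable_const_bound[where B = 1]) auto
  have "ennreal (measure_pmf.prob (bind_pmf p f) A) =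
      (\<integral>\<^sup>+x. ennreal (measure_pmf.prob (f x) A) \<partial>measure_pmf p)"
    by (simp flip: measure_pmf.emeasure_eq_measure)
  also have "\<dots> = ennreal (measure_pmf.expectation p (\<lambda>x. measure_pmf.prob (f x) A))"
    by (rule nn_integral_eq_integral[OF int]) simp
  finally show ?thesis by (simp add: integral_nonneg_AE)
qed

text \<open>A union bound for two-stage sampling: the second stage contributes at most 1 on
  \<open>B\<close> and at most \<open>c\<close> outside it.\<close>

lemma prob_bind_pmf_le:
  assumes "\<And>x. x \<in> set_pmf p \<Longrightarrow> x \<notin> B \<Longrightarrow> measure_pmf.prob (f x) A \<le> c" "0 \<le> c"
  shows "measure_pmf.prob (bind_pmf p f) A \<le> measure_pmf.prob p B + c"
proof -
  have "measure_pmf.prob (bind_pmf p f) A = measure_pmf.expectation p (\<lambda>x. measure_pmf.prob (f x) A)"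
    by (rule prob_bind_pmf_eq_expectation)
  also have "\<dots> \<le> measure_pmf.expectation p (\<lambda>x. indicator B x + c)"
  proof (rule integral_mono_AE)
    show "integrable (measure_pmf p) (\<lambda>x. measure_pmf.prob (f x) A)"
      by (rule measure_pmf.integrable_const_bound[where B = 1]) auto
    show "AE x in measure_pmf p. measure_pmf.prob (f x) A \<le> indicator B x + c"
      using assms by (auto simp: AE_measure_pmf_iff indicator_def intro: order_trans[of _ 1])
  qed (auto intro!: integrable_real_indicator simp: measure_pmf.emeasure_eq_measure)
  also have "\<dots> = measure_pmf.prob p B + c"
    by (subst Bochner_Integration.integral_add)
       (auto intro!: integrable_real_indicator simp: measure_pmf.emeasure_eq_measure)
  finally show ?thesis .
qed

section \<open>Correctness and failure of a greedy run\<close>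

lemma greedy_from_Some_dom:
  "greedy_from E L r \<pi> vs \<sigma> = Some \<tau> \<Longrightarrow> dom \<tau> = dom \<sigma> \<union> set vs"
  by (induction vs arbitrary: \<sigma>) (auto split: if_splits)

text \<open>Both conditions on \<open>\<sigma>\<close> are invariants of the run. Only edges with
  \<open>u\<close> colored are considered, because two uncolored endpoints agree in the value
  \<open>None\<close>.\<close>

lemma greedy_from_Some_proper:
  assumes "greedy_from E L r \<pi> vs \<sigma> = Some \<tau>" "valid_rule r" "\<forall>e\<in>E. card e = 2"
    and "\<forall>v\<in>dom \<sigma>. the (\<sigma> v) \<in> L v" "\<forall>u v. {u, v} \<in> E \<longrightarrow> u \<in> dom \<sigma> \<longrightarrow> \<sigma> u \<noteq> \<sigma> v"
  shows "(\<forall>v\<in>dom \<tau>. the (\<tau> v) \<in> L v) \<and> (\<forall>u v. {u, v} \<in> E \<longrightarrow> u \<in> dom \<tau> \<longrightarrow> \<tau> u \<noteq> \<tau> v)"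
  using assms(1,4,5)
proof (induction vs arbitrary: \<sigma>)
  case (Cons v vs)
  define c where "c = r \<pi> (restrict L (insert v (dom \<sigma>))) \<sigma> v (available E L \<sigma> v)"
  have av: "available E L \<sigma> v \<noteq> {}" and step: "greedy_from E L r \<pi> vs (\<sigma>(v \<mapsto> c)) = Some \<tau>"
    using Cons.prems(1) by (auto simp: c_def split: if_splits)
  have "c \<in> available E L \<sigma> v" using av assms(2) unfolding c_def valid_rule_def by blast
  then have c: "c \<in> L v" "\<And>u. {u, v} \<in> E \<Longrightarrow> \<sigma> u \<noteq> Some c"
    by (auto simp: available_def neighbors_def)
  show ?case
  proof (rule Cons.IH[OF step])
    show "\<forall>w\<in>dom (\<sigma>(v \<mapsto> c)). the ((\<sigma>(v \<mapsto> c)) w) \<in> L w"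
      using Cons.prems(2) c by auto
    \<comment> \<open>If one endpoint is \<open>v\<close>, its color \<open>c\<close> was available
      and so differs from the color of the other endpoint, which is not \<open>v\<close> because
      edges have two elements.\<close>
    have "(\<sigma>(v \<mapsto> c)) x \<noteq> (\<sigma>(v \<mapsto> c)) y" if e: "{x, y} \<in> E" and x: "x \<in> dom (\<sigma>(v \<mapsto> c))" for x y
    proof -
      have "x \<noteq> y" using e assms(3) by auto
      moreover have "{y, x} \<in> E" using e by (simp add: insert_commute)
      ultimately show ?thesis
        using Cons.prems(3) c(2)[of x] c(2)[of y] e x by (cases "x = v"; cases "y = v") auto
    qed
    then show "\<forall>x y. {x, y} \<in> E \<longrightarrow> x \<in> dom (\<sigma>(v \<mapsto> c)) \<longrightarrow> (\<sigma>(v \<mapsto> c)) x \<noteq> (\<sigma>(v \<mapsto> c)) y"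
      by blast
  qed
qed simp

lemma
  assumes "finite V" "\<pi> \<in> vertex_perms V"
  shows set_decreasing_order: "set (decreasing_order V \<pi>) = V"
    and sorted_decreasing_order: "sorted_wrt (\<lambda>x y. \<pi> y < \<pi> x) (decreasing_order V \<pi>)"
proof -
  have bij: "bij_betw \<pi> V {1..card V}" using assms by (simp add: vertex_perms_def)
  have inv: "bij_betw (inv_into V \<pi>) {1..card V} V" by (rule bij_betw_inv_into[OF bij])
  have "set (decreasing_order V \<pi>) = inv_into V \<pi> ` {1..card V}"
    by (auto simp: decreasing_order_def)
  then show "set (decreasing_order V \<pi>) = V" using inv by (simp add: bij_betw_def)
  have "sorted_wrt (\<lambda>i j. \<pi> (inv_into V \<pi> j) < \<pi> (inv_into V \<pi> i)) (rev [1..<Suc (card V)])"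
  proof (rule sorted_wrt_mono_rel[where P = "(>)"])
    fix i j assume "i \<in> set (rev [1..<Suc (card V)])" "j \<in> set (rev [1..<Suc (card V)])" "i > j"
    then show "\<pi> (inv_into V \<pi> j) < \<pi> (inv_into V \<pi> i)"
      using bij_betw_inv_into_right[OF bij, of i] bij_betw_inv_into_right[OF bij, of j] by auto
  qed (simp only: sorted_wrt_rev sorted_wrt_upt)
  then show "sorted_wrt (\<lambda>x y. \<pi> y < \<pi> x) (decreasing_order V \<pi>)"
    by (simp add: decreasing_order_def sorted_wrt_map)
qed

lemma greedy_Some_proper:
  assumes "simple_graph V E" "\<pi> \<in> vertex_perms V" "valid_rule r" "greedy V E r \<pi> L = Some \<sigma>"
  shows "proper_list_coloring V E L \<sigma>"
proof -
  have V: "finite V" "\<forall>e\<in>E. e \<subseteq> V \<and> card e = 2" using assms(1) by (auto simp: simple_graph_def)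
  have run: "greedy_from E L r \<pi> (decreasing_order V \<pi>) Map.empty = Some \<sigma>"
    using assms(4) by (simp add: greedy_def)
  have dom: "dom \<sigma> = V"
    using greedy_from_Some_dom[OF run] set_decreasing_order[OF V(1) assms(2)] by simp
  have "(\<forall>v\<in>dom \<sigma>. the (\<sigma> v) \<in> L v) \<and> (\<forall>u v. {u, v} \<in> E \<longrightarrow> u \<in> dom \<sigma> \<longrightarrow> \<sigma> u \<noteq> \<sigma> v)"
    using V by (intro greedy_from_Some_proper[OF run assms(3)]) auto
  then show ?thesis
    using V(2) dom unfolding proper_list_coloring_def by blast
qed

text \<open>A run reads only the lists of colored vertices and of vertices still to come.\<close>

lemma greedy_from_cong:
  assumes "\<And>w. w \<in> dom \<sigma> \<union> set vs \<Longrightarrow> L w = L' w"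
  shows "greedy_from E L r \<pi> vs \<sigma> = greedy_from E L' r \<pi> vs \<sigma>"
  using assms
proof (induction vs arbitrary: \<sigma>)
  case (Cons v vs)
  have "available E L \<sigma> v = available E L' \<sigma> v"
    using Cons.prems by (simp add: available_def)
  moreover have "restrict L (insert v (dom \<sigma>)) = restrict L' (insert v (dom \<sigma>))"
    using Cons.prems by (intro restrict_ext) auto
  moreover have "greedy_from E L r \<pi> vs (\<sigma>(v \<mapsto> c)) = greedy_from E L' r \<pi> vs (\<sigma>(v \<mapsto> c))" for c
  proof (rule Cons.IH)
    fix w assume "w \<in> dom (\<sigma>(v \<mapsto> c)) \<union> set vs"
    then have "w \<in> dom \<sigma> \<union> set (v # vs)" by auto
    then show "L w = L' w" by (rule Cons.prems)
  qed
  ultimately show ?case by simp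
qed simp

text \<open>The lists of the vertices that were already processed are fixed to \<open>L0\<close>: the partial coloring
  \<open>\<sigma>\<close> may depend on them, but not on the fresh lists \<open>L\<close>. The assumption \<open>miss\<close> bounds the
  conditional probability that a vertex gets stuck, whatever coloring it meets.\<close>

lemma prob_greedy_from_None_le:
  fixes p :: "'v \<Rightarrow> 'c set pmf"
  assumes "distinct vs" "dom \<sigma> \<inter> set vs = {}"
    and miss: "\<And>us v ws \<tau>. vs = us @ v # ws \<Longrightarrow> dom \<tau> = dom \<sigma> \<union> set us \<Longrightarrow>
       measure_pmf.prob (p v) {X. X \<subseteq> {c. \<exists>u\<in>neighbors E v. \<tau> u = Some c}} \<le> b v"
  shows "measure_pmf.prob (Pi_pmf (set vs) {} p)
           {L. greedy_from E (override_on L0 L (set vs)) r \<pi> vs \<sigma> = None} \<le> (\<Sum>v\<in>set vs. b v)"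
  using assms
proof (induction vs arbitrary: \<sigma> L0)
  case (Cons v vs)
  have v: "v \<notin> set vs" "v \<notin> dom \<sigma>" using Cons.prems by auto
  define U where "U = {c. \<exists>u\<in>neighbors E v. \<sigma> u = Some c}"
  define \<sigma>' where "\<sigma>' X = \<sigma>(v \<mapsto> r \<pi> (restrict (L0(v := X)) (insert v (dom \<sigma>))) \<sigma> v (X - U))" for X
  have dom': "dom (\<sigma>' X) = insert v (dom \<sigma>)" for X by (simp add: \<sigma>'_def)
  let ?A = "{L. greedy_from E (override_on L0 L (set (v # vs))) r \<pi> (v # vs) \<sigma> = None}"
  \<comment> \<open>If \<open>v\<close> is not stuck, its list \<open>X\<close> joins the fixed
    lists, leaving a run on \<open>vs\<close> with fresh lists. This relies on the choice rule not
    seeing the lists of later vertices.\<close>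
  have step: "L(v := X) \<in> ?A \<longleftrightarrow>
      L \<in> {L. greedy_from E (override_on (L0(v := X)) L (set vs)) r \<pi> vs (\<sigma>' X) = None}"
    if X: "\<not> X \<subseteq> U" for X L
  proof -
    let ?M = "override_on L0 (L(v := X)) (set (v # vs))"
    have M: "?M = override_on (L0(v := X)) L (set vs)"
      using v by (auto simp: override_on_def fun_eq_iff)
    have av: "available E ?M \<sigma> v = X - U"
      using v by (simp add: available_def U_def override_on_def)
    have "restrict ?M (insert v (dom \<sigma>)) = restrict (L0(v := X)) (insert v (dom \<sigma>))"
      using Cons.prems(2) v by (intro restrict_ext) (auto simp: override_on_def)
    then have run: "greedy_from E ?M r \<pi> (v # vs) \<sigma> = greedy_from E ?M r \<pi> vs (\<sigma>' X)"
      using X av by (simp add: \<sigma>'_def Diff_eq_empty_iff)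
    show ?thesis by (simp only: mem_Collect_eq run) (simp only: M)
  qed
  \<comment> \<open>Probabilities are nonnegative, so \<open>miss\<close> at any coloring with the
    required domain suffices; a constant one serves as witness.\<close>
  have b_nonneg: "0 \<le> b w" if w: "w \<in> set vs" for w
  proof -
    obtain us ws where "vs = us @ w # ws" using split_list[OF w] by blast
    moreover obtain \<tau> :: "'v \<rightharpoonup> 'c" where "dom \<tau> = dom \<sigma> \<union> set (v # us)"
    proof
      show "dom ((\<lambda>_. Some undefined) |` (dom \<sigma> \<union> set (v # us))) = dom \<sigma> \<union> set (v # us)"
        by (simp add: dom_restrict)
    qed
    ultimately show ?thesis
      using Cons.prems(3)[of "v # us" w ws \<tau>] by (auto intro: order_trans[OF measure_nonneg])
  qed
  \<comment> \<open>By independence the list of \<open>v\<close> can be drawn first. Then either it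
    lies within the used colors \<open>U\<close>, or the failure happens at a later vertex.\<close>
  have "Pi_pmf (set (v # vs)) {} p =
      bind_pmf (p v) (\<lambda>X. map_pmf (\<lambda>L. L(v := X)) (Pi_pmf (set vs) {} p))"
    using v by (simp add: Pi_pmf_insert' map_pmf_def)
  then have "measure_pmf.prob (Pi_pmf (set (v # vs)) {} p) ?A =
      measure_pmf.prob (bind_pmf (p v) (\<lambda>X. map_pmf (\<lambda>L. L(v := X)) (Pi_pmf (set vs) {} p))) ?A"
    by simp
  also have "\<dots> \<le> measure_pmf.prob (p v) {X. X \<subseteq> U} + (\<Sum>w\<in>set vs. b w)"
  proof (rule prob_bind_pmf_le)
    fix X assume X: "X \<notin> {X. X \<subseteq> U}"
    have "measure_pmf.prob (map_pmf (\<lambda>L. L(v := X)) (Pi_pmf (set vs) {} p)) ?A =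
        measure_pmf.prob (Pi_pmf (set vs) {} p)
          {L. greedy_from E (override_on (L0(v := X)) L (set vs)) r \<pi> vs (\<sigma>' X) = None}"
      using step X by (simp add: vimage_def)
    also have "\<dots> \<le> (\<Sum>w\<in>set vs. b w)"
    proof (rule Cons.IH)
      show "distinct vs" "dom (\<sigma>' X) \<inter> set vs = {}" using Cons.prems by (auto simp: dom')
      show "measure_pmf.prob (p w) {X. X \<subseteq> {c. \<exists>u\<in>neighbors E w. \<tau> u = Some c}} \<le> b w"
        if "vs = us @ w # ws" "dom \<tau> = dom (\<sigma>' X) \<union> set us" for us w ws \<tau>
        using that Cons.prems(3)[of "v # us" w ws \<tau>] by (simp add: dom')
    qed
    finally show "measure_pmf.prob (map_pmf (\<lambda>L. L(v := X)) (Pi_pmf (set vs) {} p)) ?A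
        \<le> (\<Sum>w\<in>set vs. b w)" .
  qed (auto intro: sum_nonneg b_nonneg)
  also have "measure_pmf.prob (p v) {X. X \<subseteq> U} \<le> b v"
    unfolding U_def using Cons.prems(3)[of "[]" v vs \<sigma>] by simp
  finally show ?case using v by simp
qed simp

section \<open>Failure probability for a fixed permutation and on average\<close>

definition list_length :: "'v set \<Rightarrow> 'v set set \<Rightarrow> ('v \<Rightarrow> nat) \<Rightarrow> 'v \<Rightarrow> nat" where
  "list_length V E \<pi> v = nat \<lceil>list_size V E \<pi> v\<rceil>"

definition stuck_bound :: "'v set \<Rightarrow> 'v set set \<Rightarrow> ('v \<Rightarrow> nat) \<Rightarrow> 'v \<Rightarrow> real" where
  "stuck_bound V E \<pi> v =
     (1 - real (list_length V E \<pi> v) / real (deg E v + 1)) ^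
       (card {w \<in> neighbors E v. \<pi> w < \<pi> v} + 1)"

lemma list_length_le: "list_length V E \<pi> v \<le> deg E v + 1"
  by (auto simp: list_length_def list_size_def nat_le_iff ceiling_le_iff)

lemma neighbors_subset: "simple_graph V E \<Longrightarrow> neighbors E v \<subseteq> V - {v}"
  by (auto simp: simple_graph_def neighbors_def)

text \<open>The neighbors before \<open>v\<close> use at most one color each, so at least
  \<open>card after + 1\<close> of the \<open>deg E v + 1\<close> colors remain; being stuck means
  that the list misses all of them.\<close>

lemma prob_stuck_le:
  assumes "simple_graph V E" "\<pi> \<in> vertex_perms V" "v \<in> V" "card (S v) = deg E v + 1"
    and dom: "dom \<tau> = {w \<in> V. \<pi> v < \<pi> w}"
  shows "measure_pmf.prob (random_list V E S \<pi> v) {X. X \<subseteq> {c. \<exists>u\<in>neighbors E v. \<tau> u = Some c}}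
         \<le> stuck_bound V E \<pi> v"
proof -
  define U where "U = {c. \<exists>u\<in>neighbors E v. \<tau> u = Some c}"
  let ?N = "neighbors E v"
  define before after where "before = {w \<in> ?N. \<pi> v < \<pi> w}" and "after = {w \<in> ?N. \<pi> w < \<pi> v}"
  have N: "?N \<subseteq> V - {v}" by (rule neighbors_subset[OF assms(1)])
  have finV: "finite V" using assms(1) by (simp add: simple_graph_def)
  then have finN: "finite ?N" using N finite_subset by blast
  have inj: "inj_on \<pi> V" using assms(2) by (simp add: vertex_perms_def bij_betw_def)
  have "?N = before \<union> after"
  proof -
    have "\<pi> w \<noteq> \<pi> v" if "w \<in> ?N" for w
      using that N inj assms(3) by (auto dest: inj_onD)
    then show ?thesis by (auto simp: before_def after_def neq_iff)
  qed
  moreover have "before \<inter> after = {}" by (auto simp: before_def after_def)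
  ultimately have deg: "deg E v = card before + card after"
    using finN by (simp add: deg_def card_Un_disjoint)
  have fS: "finite (S v)" using assms(4) by (metis Suc_eq_plus1 card.infinite nat.distinct(1))
  have "U \<subseteq> (\<lambda>u. the (\<tau> u)) ` before"
  proof
    fix c assume "c \<in> U"
    then obtain u where u: "u \<in> ?N" "\<tau> u = Some c" by (auto simp: U_def)
    then have "u \<in> dom \<tau>" by auto
    then have "u \<in> before" using u(1) dom by (simp add: before_def)
    then show "c \<in> (\<lambda>u. the (\<tau> u)) ` before" using u(2) by force
  qed
  moreover have finb: "finite before" using finN by (simp add: before_def)
  ultimately have cU: "finite U" "card U \<le> card before"
    by (auto intro: finite_subset order_trans[OF card_mono card_image_le])
  have "card (S v) - card U \<le> card (S v - U)" by (rule diff_card_le_card_Diff[OF cU(1)])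
  then have cA: "card after + 1 \<le> card (S v - U)" using cU deg assms(4) by simp
  have "measure_pmf.prob (random_list V E S \<pi> v) {X. X \<subseteq> U} \<le>
        measure_pmf.prob (random_list V E S \<pi> v) {X. X \<inter> (S v - U) = {}}"
    by (rule measure_pmf.finite_measure_mono) auto
  also have "\<dots> \<le> (1 - real (list_length V E \<pi> v) / real (card (S v))) ^ card (S v - U)"
    unfolding random_list_def list_length_def[symmetric]
    using fS assms(4) list_length_le[of V E \<pi> v] by (intro prob_random_subset_misses) auto
  also have "\<dots> \<le> stuck_bound V E \<pi> v"
    unfolding stuck_bound_def assms(4) after_def[symmetric]
    using cA list_length_le[of V E \<pi> v] by (intro power_decreasing) auto
  finally show ?thesis unfolding U_def .
qed

lemma prob_greedy_None_le:
  fixes S :: "'v \<Rightarrow> 'c set"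
  assumes "simple_graph V E" "\<pi> \<in> vertex_perms V" "\<forall>v\<in>V. card (S v) = deg E v + 1"
  shows "measure_pmf.prob (Pi_pmf V {} (random_list V E S \<pi>)) {L. greedy V E r \<pi> L = None}
         \<le> (\<Sum>v\<in>V. stuck_bound V E \<pi> v)"
proof -
  let ?vs = "decreasing_order V \<pi>"
  have finV: "finite V" using assms(1) by (simp add: simple_graph_def)
  have set: "set ?vs = V" and sorted: "sorted_wrt (\<lambda>x y. \<pi> y < \<pi> x) ?vs"
    using set_decreasing_order sorted_decreasing_order finV assms(2) by auto
  have dist: "distinct ?vs"
    using sorted by (auto simp: distinct_conv_nth sorted_wrt_iff_nth_less nat_neq_iff)
       (metis less_irrefl nat_neq_iff)+
  have "measure_pmf.prob (Pi_pmf (set ?vs) {} (random_list V E S \<pi>))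
      {L. greedy_from E (override_on (\<lambda>_. {}) L (set ?vs)) r \<pi> ?vs Map.empty = None}
      \<le> (\<Sum>v\<in>set ?vs. stuck_bound V E \<pi> v)"
  proof (rule prob_greedy_from_None_le[OF dist])
    fix us v ws and \<tau> :: "'v \<rightharpoonup> 'c"
    assume vs: "?vs = us @ v # ws" and dom: "dom \<tau> = dom Map.empty \<union> set us"
    have V: "V = set us \<union> {v} \<union> set ws" using set vs by auto
    have "\<pi> v < \<pi> x" if "x \<in> set us" for x
      using sorted that unfolding vs by (auto simp: sorted_wrt_append)
    moreover have "\<pi> x < \<pi> v" if "x \<in> set ws" for x
      using sorted that unfolding vs by (auto simp: sorted_wrt_append)
    ultimately have "set us = {w \<in> V. \<pi> v < \<pi> w}"
      using V by (auto dest: less_asym)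
    then show "measure_pmf.prob (random_list V E S \<pi> v)
        {X. X \<subseteq> {c. \<exists>u\<in>neighbors E v. \<tau> u = Some c}} \<le> stuck_bound V E \<pi> v"
      using assms dom V by (intro prob_stuck_le) auto
  qed simp
  moreover have "greedy_from E (override_on (\<lambda>_. {}) L (set ?vs)) r \<pi> ?vs Map.empty =
      greedy V E r \<pi> L" for L
    unfolding greedy_def by (rule greedy_from_cong) auto
  ultimately show ?thesis by (simp add: set)
qed

text \<open>As \<open>s < d + 1\<close>, the minimum is its second argument \<open>x\<close>, and
  \<open>s \<ge> x\<close>. With \<open>d / (d + 1) \<ge> 1 / 2\<close> and
  \<open>p \<ge> i / (2 * n)\<close>, the exponent \<open>d * t * p\<close> is at least
  \<open>10 * ln n\<close>, more than the required \<open>2 * ln n\<close>.\<close>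

lemma stuck_bound_tail:
  fixes d i n s :: nat
  assumes "n \<ge> 2" "1 \<le> i" "i \<le> n" "d + 1 \<le> n"
    and s: "s = nat \<lceil>min (real d + 1) (40 * real n * ln (real n) / real i)\<rceil>" "s < d + 1"
  shows "(1 - real s / real (d + 1) * (real (i - 1) / real (n - 1))) ^ d \<le> 1 / real n ^ 2"
proof -
  define x where "x = 40 * real n * ln (real n) / real i"
  have ln: "ln (real n) \<ge> 1 / 2"
  proof -
    have "ln 2 \<le> ln (real n)" using assms(1) by simp
    then show ?thesis using ln2_ge_two_thirds by linarith
  qed
  have sx: "min (real d + 1) x \<le> real s" unfolding s(1) x_def by linarith
  then have x: "x \<le> real s" using s(2) by (auto simp: min_def split: if_splits)
  have x1: "20 * (real n / real i) \<le> x"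
    using ln mult_left_mono[OF ln, of "40 * (real n / real i)"] by (simp add: x_def)
  have ni: "1 \<le> real n / real i" using assms by simp
  \<comment> \<open>For \<open>i = 1\<close> the list would have at least
    \<open>n \<ge> d + 1\<close> colors. Excluding this case gives \<open>i - 1 \<ge> i / 2\<close>,
    from which \<open>p2\<close> follows.\<close>
  have i2: "i \<ge> 2"
  proof (rule ccontr)
    assume "\<not> i \<ge> 2"
    then have "i = 1" using assms(2) by simp
    then have "real n \<le> x" using x1 by simp
    then show False using x s(2) assms(4) by linarith
  qed
  have d1: "d \<ge> 1"
  proof (rule ccontr)
    assume "\<not> d \<ge> 1"
    then show False using s(2) x x1 ni by simp
  qed
  define t p where "t = real s / real (d + 1)" and "p = real (i - 1) / real (n - 1)"
  have t: "0 \<le> t" "t \<le> 1" using s(2) by (auto simp: t_def)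
  have p: "0 \<le> p" "p \<le> 1" using assms by (auto simp: p_def divide_le_eq)
  have p2: "real i / (2 * real n) \<le> p"
  proof -
    have "real i * (real n - 1) \<le> (2 * (real i - 1)) * real n"
      using i2 assms by (intro mult_mono) auto
    then show ?thesis using assms by (simp add: p_def field_simps of_nat_diff)
  qed
  have td: "x / 2 \<le> t * real d"
  proof -
    have "real s * (1 / 2) \<le> real s * (real d / real (d + 1))"
      using d1 by (intro mult_left_mono) (auto simp: field_simps)
    then show ?thesis using x by (simp add: t_def)
  qed
  have "2 * ln (real n) \<le> (x / 2) * (real i / (2 * real n))"
    using assms ln by (simp add: x_def)
  also have "\<dots> \<le> (t * real d) * p"
    using td p2 t x x1 ni by (intro mult_mono) auto
  finally have exponent: "2 * ln (real n) \<le> real d * (t * p)" by (simp add: mult_ac)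
  have tp: "t * p \<le> 1" using t p by (simp add: mult_le_one)
  have "(1 - t * p) ^ d \<le> exp (- (t * p)) ^ d"
    using tp exp_ge_add_one_self[of "- (t * p)"] by (intro power_mono) auto
  also have "\<dots> = exp (- (real d * (t * p)))" by (simp flip: exp_of_nat_mult)
  also have "\<dots> \<le> exp (- (2 * ln (real n)))" using exponent by simp
  also have "\<dots> = 1 / real n ^ 2"
    using assms(1) exp_of_nat_mult[of 2 "ln (real n)"] by (simp add: exp_minus inverse_eq_divide)
  finally show ?thesis by (simp add: t_def p_def)
qed

lemma sum_stuck_bound_le:
  assumes "simple_graph V E" "v \<in> V" "card V \<ge> 2"
  shows "(\<Sum>\<pi>\<in>bijections V {1..card V}. stuck_bound V E \<pi> v) \<le> fact (card V) * (1 / real (card V) ^ 2)"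
proof -
  let ?n = "card V" and ?N = "neighbors E v" and ?d = "deg E v"
  let ?T = "{1..?n}"
  have finV: "finite V" using assms(1) by (simp add: simple_graph_def)
  have N: "?N \<subseteq> V - {v}" by (rule neighbors_subset[OF assms(1)])
  have "?d \<le> card (V - {v})" unfolding deg_def using N finV by (intro card_mono) auto
  then have dn: "?d + 1 \<le> ?n" using finV assms by simp
  define s where "s i = nat \<lceil>min (real ?d + 1) (40 * real ?n * ln (real ?n) / real i)\<rceil>" for i
  have "(\<Sum>\<pi>\<in>bijections V ?T. stuck_bound V E \<pi> v) =
      (\<Sum>i\<in>?T. \<Sum>f\<in>bijections (V - {v}) (?T - {i}). stuck_bound V E (f(v := i)) v)"
    using finV assms(2) by (intro sum_bijections_fix_point) auto
  also have "\<dots> \<le> (\<Sum>i\<in>?T. fact (?n - 1) * (1 / real ?n ^ 2))"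
  proof (rule sum_mono)
    fix i assume i: "i \<in> ?T"
    let ?z = "1 - real (s i) / real (?d + 1)"
    have len: "list_length V E (f(v := i)) v = s i" for f
      by (simp add: list_length_def list_size_def s_def)
    then have sle: "s i \<le> ?d + 1" using list_length_le by metis
    then have z: "0 \<le> ?z" "?z \<le> 1" by auto
    \<comment> \<open>The value \<open>i\<close> is taken by \<open>v\<close>, so a neighbor has a
      smaller value iff its value is outside \<open>{i<..?n}\<close>, which becomes the set
      \<open>T0\<close> of \<open>sum_bijections_power_le\<close>.\<close>
    have eq: "stuck_bound V E (f(v := i)) v = ?z ^ (card {w \<in> ?N. f w \<notin> {i<..?n}} + 1)"
      if "f \<in> bijections (V - {v}) (?T - {i})" for f
    proof -
      have "f w \<in> ?T - {i}" "w \<noteq> v" if "w \<in> ?N" for w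
        using that N \<open>f \<in> _\<close> by (auto simp: bijections_def PiE_def Pi_def)
      then have "{w \<in> ?N. (f(v := i)) w < (f(v := i)) v} = {w \<in> ?N. f w \<notin> {i<..?n}}"
        by (fastforce simp: not_less order_le_less)
      then show ?thesis by (simp only: stuck_bound_def len)
    qed
    show "(\<Sum>f\<in>bijections (V - {v}) (?T - {i}). stuck_bound V E (f(v := i)) v) \<le>
        fact (?n - 1) * (1 / real ?n ^ 2)"
    proof (cases "s i = ?d + 1")
      \<comment> \<open>A full list is never stuck: the base is 0, and the \<open>+ 1\<close> keeps
        the exponent positive even if no neighbor comes later.\<close>
      case True
      have "(\<Sum>f\<in>bijections (V - {v}) (?T - {i}). stuck_bound V E (f(v := i)) v) = 0"
        using eq True by (intro sum.neutral) simp
      then show ?thesis by simp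
    next
      case False
      have "(\<Sum>f\<in>bijections (V - {v}) (?T - {i}). stuck_bound V E (f(v := i)) v) \<le>
          (\<Sum>f\<in>bijections (V - {v}) (?T - {i}). ?z ^ card {w \<in> ?N. f w \<notin> {i<..?n}})"
        using z by (intro sum_mono) (simp only: eq, rule power_decreasing, auto)
      also have "\<dots> \<le> fact (card (V - {v})) *
          (?z + (1 - ?z) * (real (card {i<..?n}) / real (card (V - {v})))) ^ card ?N"
        using finV i assms(2) N z by (intro sum_bijections_power_le) auto
      also have "\<dots> = fact (?n - 1) *
          (1 - real (s i) / real (?d + 1) * (real (i - 1) / real (?n - 1))) ^ ?d"
      proof -
        \<comment> \<open>Of the other \<open>?n - 1\<close> values, \<open>?n - i\<close> exceed
          \<open>i\<close>: the ratio is the chance that a given neighbor comes before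
          \<open>v\<close>.\<close>
        have ratio: "real (card {i<..?n}) / real (?n - 1) = 1 - real (i - 1) / real (?n - 1)"
          using i assms(3) by (simp add: field_simps of_nat_diff)
        have card: "card (V - {v}) = ?n - 1" using finV assms(2) by simp
        have "(1 - t) + (1 - (1 - t)) * (1 - p) = 1 - t * p" for t p :: real
          by (simp add: algebra_simps)
        then show ?thesis by (simp only: card ratio deg_def)
      qed
      also have "\<dots> \<le> fact (?n - 1) * (1 / real ?n ^ 2)"
        using False sle i assms(3) dn
        by (intro mult_left_mono stuck_bound_tail[where s = "s i"] s_def) auto
      finally show ?thesis .
    qed
  qed
  also have "\<dots> = fact ?n * (1 / real ?n ^ 2)"
    using assms(3) by (simp add: fact_reduce[of ?n])
  finally show ?thesis .
qed

lemma prob_greedy_proper_ge: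
  fixes S :: "'v \<Rightarrow> 'c set" and r :: "('v, 'c) choice_rule"
  assumes "simple_graph V E" "\<forall>v\<in>V. card (S v) = deg E v + 1" "valid_rule r"
  shows "measure_pmf.prob (random_perm_and_lists V E S)
          {(\<pi>, L). \<exists>\<sigma>. greedy V E r \<pi> L = Some \<sigma> \<and> proper_list_coloring V E L \<sigma>}
         \<ge> 1 - 1 / real (card V)"
proof (cases "card V = 1")
  \<comment> \<open>For one vertex the bound is 0, hence trivial. The empty graph falls under this
    case: \<open>1 / 0 = 0\<close>, and the sum over the vertices is empty.\<close>
  case False
  let ?n = "card V"
  let ?good = "{(\<pi>, L). \<exists>\<sigma>. greedy V E r \<pi> L = Some \<sigma> \<and> proper_list_coloring V E L \<sigma>}"
  let ?B = "bijections V {1..?n}"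
  have finV: "finite V" using assms(1) by (simp add: simple_graph_def)
  have "1 - measure_pmf.prob (random_perm_and_lists V E S) ?good =
      measure_pmf.prob (random_perm_and_lists V E S) (- ?good)"
    by (subst measure_pmf.prob_compl[of ?good "random_perm_and_lists V E S", simplified, symmetric])
       (simp add: Compl_eq_Diff_UNIV)
  also have "\<dots> = measure_pmf.expectation (random_perm V) (\<lambda>\<pi>.
      measure_pmf.prob (Pi_pmf V {} (random_list V E S \<pi>)) {L. (\<pi>, L) \<notin> ?good})"
    unfolding random_perm_and_lists_def by (simp add: prob_bind_pmf_eq_expectation vimage_def)
  also have "\<dots> = (\<Sum>\<pi>\<in>?B. measure_pmf.prob (Pi_pmf V {} (random_list V E S \<pi>)) {L. (\<pi>, L) \<notin> ?good}) /
      fact ?n"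
    by (rule expectation_random_perm[OF finV])
  also have "\<dots> \<le> (\<Sum>\<pi>\<in>?B. \<Sum>v\<in>V. stuck_bound V E \<pi> v) / fact ?n"
  proof (intro divide_right_mono sum_mono)
    fix \<pi> assume "\<pi> \<in> ?B"
    then have \<pi>: "\<pi> \<in> vertex_perms V" by (simp add: vertex_perms_eq_bijections)
    have "{L. (\<pi>, L) \<notin> ?good} \<subseteq> {L. greedy V E r \<pi> L = None}"
      using greedy_Some_proper[OF assms(1) \<pi> assms(3)] by fastforce
    then have "measure_pmf.prob (Pi_pmf V {} (random_list V E S \<pi>)) {L. (\<pi>, L) \<notin> ?good} \<le>
        measure_pmf.prob (Pi_pmf V {} (random_list V E S \<pi>)) {L. greedy V E r \<pi> L = None}"
      by (rule measure_pmf.finite_measure_mono) simp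
    also have "\<dots> \<le> (\<Sum>v\<in>V. stuck_bound V E \<pi> v)"
      using assms \<pi> by (intro prob_greedy_None_le)
    finally show "measure_pmf.prob (Pi_pmf V {} (random_list V E S \<pi>)) {L. (\<pi>, L) \<notin> ?good} \<le>
        (\<Sum>v\<in>V. stuck_bound V E \<pi> v)" .
  qed simp
  also have "\<dots> = (\<Sum>v\<in>V. \<Sum>\<pi>\<in>?B. stuck_bound V E \<pi> v) / fact ?n"
    by (subst sum.swap) simp
  also have "\<dots> \<le> (\<Sum>v\<in>V. fact ?n * (1 / real ?n ^ 2)) / fact ?n"
  proof (intro divide_right_mono sum_mono)
    fix v assume "v \<in> V"
    then have "?n \<ge> 2" using False finV card_gt_0_iff[of V] by auto
    then show "(\<Sum>\<pi>\<in>?B. stuck_bound V E \<pi> v) \<le> fact ?n * (1 / real ?n ^ 2)"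
      using assms(1) \<open>v \<in> V\<close> by (intro sum_stuck_bound_le)
  qed simp
  also have "\<dots> = 1 / real ?n" by (simp add: power2_eq_square)
  finally show ?thesis by simp
qed simp

theorem theorem3p1:
  shows
    "(\<exists>C::real. \<forall>(V :: 'v set) E \<pi>.
        simple_graph V E \<longrightarrow> \<pi> \<in> vertex_perms V \<longrightarrow>
        (\<Sum>v\<in>V. list_size V E \<pi> v) \<le> C * (real (card V) * (ln (real (card V)))^2))
   \<and> (\<exists>C::real. \<forall>(V :: 'v set) E v.
        simple_graph V E \<longrightarrow> v \<in> V \<longrightarrow>
        measure_pmf.expectation (random_perm V) (\<lambda>\<pi>. list_size V E \<pi> v)
          \<le> C * (ln (real (card V)))^2)
   \<and> (\<exists>C::real. \<forall>(V :: 'v set) E u v.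
        simple_graph V E \<longrightarrow> u \<in> V \<longrightarrow> v \<in> V \<longrightarrow> u \<noteq> v \<longrightarrow>
        measure_pmf.expectation (random_perm V) (\<lambda>\<pi>. list_size V E \<pi> u * list_size V E \<pi> v)
          \<le> C * (ln (real (card V)))^4)
   \<and> (\<exists>k::nat. k \<ge> 1 \<and> (\<forall>(V :: 'v set) E (S :: 'v \<Rightarrow> 'c set) (r :: ('v, 'c) choice_rule).
        simple_graph V E \<longrightarrow> (\<forall>v\<in>V. card (S v) = deg E v + 1) \<longrightarrow> valid_rule r \<longrightarrow>
        measure_pmf.prob (random_perm_and_lists V E S)
          {(\<pi>, L). \<exists>\<sigma>. greedy V E r \<pi> L = Some \<sigma> \<and> proper_list_coloring V E L \<sigma>}
          \<ge> 1 - 1 / real (card V) ^ k))"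
proof (intro conjI)
  show "\<exists>k::nat. k \<ge> 1 \<and> (\<forall>(V :: 'v set) E (S :: 'v \<Rightarrow> 'c set) (r :: ('v, 'c) choice_rule).
        simple_graph V E \<longrightarrow> (\<forall>v\<in>V. card (S v) = deg E v + 1) \<longrightarrow> valid_rule r \<longrightarrow>
        measure_pmf.prob (random_perm_and_lists V E S)
          {(\<pi>, L). \<exists>\<sigma>. greedy V E r \<pi> L = Some \<sigma> \<and> proper_list_coloring V E L \<sigma>}
          \<ge> 1 - 1 / real (card V) ^ k)"
    \<comment> \<open>The witness is 1: each of the \<open>n\<close> vertices contributes at most
      \<open>1 / n ^ 2\<close>.\<close>
    using prob_greedy_proper_ge by (intro exI[of _ 1]) (simp only: power_one_right, blast)
qed (use sum_list_size_le expectation_list_size_le expectation_list_size_mult_le in blast)+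

end
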